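(* Let $(x_n)_{n=1}^{\infty}$ be a sequence on $[0,1]$ and assume that for all $s \in \mathbb{N}$ (positive integers) $$ \lim_{N \rightarrow \infty} \frac{1}{N} \# \left\{ (m,n): 1 \leq m \neq n \leq N,\ |x_m - x_n| \leq \frac{s}{N} \right\} = 2s.$$ Then the sequence $(x_n)_{n=1}^\infty$ is uniformly distributed on $[0,1]$.
   Context: The count is over ordered pairs $(m,n)$ with $m\ne n$. A sequence on $[0,1]$ is uniformly distributed if for every interval $J\subset[0,1]$, $\lim_{N\to\infty}\frac1N\#\{1\le i\le N: x_i\in J\}=|J|$, where $|J|$ is the length of $J$. *)

theory Defs
  imports "HOL-Analysis.Analysis"
begin

text \<open>
  Sequences are indexed from 1; the value \<open>x 0\<close> is never used.  The intervals \<open>J\<close> may be open,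
  closed, half-open or degenerate, and their length is their Lebesgue measure.
\<close>

definition uniformly_distributed :: "(nat \<Rightarrow> real) \<Rightarrow> bool" where
  "uniformly_distributed x \<longleftrightarrow>
     (\<forall>J. is_interval J \<and> J \<subseteq> {0..1} \<longrightarrow>
        (\<lambda>N. 1 / real N * real (card {i. 1 \<le> i \<and> i \<le> N \<and> x i \<in> J}))
          \<longlonglongrightarrow> measure lborel J)"

definition close_pairs :: "(nat \<Rightarrow> real) \<Rightarrow> real \<Rightarrow> nat \<Rightarrow> (nat \<times> nat) set" where
  "close_pairs x s N =
     {(m, n). 1 \<le> m \<and> m \<le> N \<and> 1 \<le> n \<and> n \<le> N \<and> m \<noteq> n \<and> \<bar>x m - x n\<bar> \<le> s / real N}"

end

theory Submission
  imports Defs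
begin

text \<open>
  Cut the line into cells of length \<open>1 / N\<close> and let \<open>F j\<close> be the number of points among
  \<open>x 1, \<dots>, x N\<close> in the \<open>s\<close> consecutive cells starting at cell \<open>j\<close>.  The sum of the \<open>F j\<close>
  is \<open>s N\<close>, and the sum of their squares is controlled by the close pair counts at the scales
  \<open>1, \<dots>, s + 1\<close>, which gives at most \<open>(s\<^sup>2 + 4 s + 2) N + o(N)\<close>.  Hence \<open>\<Sum>j. (F j - s)\<^sup>2\<close>
  is at most \<open>(4 s + 2) N + o(N)\<close>: relative to its mean \<open>s\<close> the function \<open>F\<close> has
  variance \<open>O(1 / s)\<close>.  So asymptotically no interval \<open>[a, b]\<close> holds a proportion of points
  exceeding \<open>b - a\<close> by more than any fixed amount; applied to \<open>[0, a]\<close> and \<open>[b, 1]\<close> as well, this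
  also gives the lower bound.
\<close>

section \<open>Cells and sliding windows\<close>

text \<open>The point 1 gets a cell of its own, number \<open>N\<close>. For points of [0,1] the
  cells are thus 0, ..., \<open>N\<close>, and a window of \<open>s\<close> cells can catch a point
  only if it starts between \<open>1 - s\<close> and \<open>N\<close>.\<close>

definition cell :: "(nat \<Rightarrow> real) \<Rightarrow> nat \<Rightarrow> nat \<Rightarrow> int" where
  "cell x N i = \<lfloor>real N * x i\<rfloor>"

definition in_window :: "(nat \<Rightarrow> real) \<Rightarrow> nat \<Rightarrow> nat \<Rightarrow> int \<Rightarrow> nat \<Rightarrow> real" where
  "in_window x N s j i = of_bool (j \<le> cell x N i \<and> cell x N i < j + int s)"

definition window_count :: "(nat \<Rightarrow> real) \<Rightarrow> nat \<Rightarrow> nat \<Rightarrow> int \<Rightarrow> real" where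
  "window_count x N s j = (\<Sum>i\<in>{1..N}. in_window x N s j i)"

text \<open>The set \<open>A\<close> stays general because two ranges of windows are summed over
  later: all of them, and those that meet a given interval.\<close>

lemma sum_in_window:
  assumes "finite A" "{cell x N i - int s + 1..cell x N i} \<subseteq> A"
  shows "(\<Sum>j\<in>A. in_window x N s j i) = real s"
proof -
  have "(\<Sum>j\<in>A. in_window x N s j i)
      = real (card (A \<inter> {j. j \<le> cell x N i \<and> cell x N i < j + int s}))"
    using assms(1) by (simp add: in_window_def sum_of_bool_eq Collect_conj_eq)
  also have "A \<inter> {j. j \<le> cell x N i \<and> cell x N i < j + int s} = {cell x N i - int s + 1..cell x N i}"
    using assms(2) by auto
  finally show ?thesis by simp
qed

lemma cell_bounds:
  assumes "0 \<le> x i" "x i \<le> 1"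
  shows "0 \<le> cell x N i" "cell x N i \<le> int N"
  using assms mult_left_mono[of "x i" 1 "real N"] by (auto simp: cell_def floor_le_iff)

lemma cell_diff_less: "real N * \<bar>x m - x n\<bar> < of_int \<bar>cell x N m - cell x N n\<bar> + 1"
proof -
  have "real N * \<bar>x m - x n\<bar> = \<bar>real N * x m - real N * x n\<bar>"
    by (simp add: abs_mult flip: right_diff_distrib)
  then show ?thesis unfolding cell_def by linarith
qed

text \<open>Two points whose cells are k apart share at most max(\<open>s\<close> - k, 0) windows.
  Their distance is below (k + 1) / \<open>N\<close>, so they are also a close pair at each of the
  scales k + 1, ..., \<open>s\<close>.\<close>

lemma sum_in_window_pair:
  assumes "finite A" "N > 0"
  shows "(\<Sum>j\<in>A. in_window x N s j m * in_window x N s j n)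
     \<le> (\<Sum>r\<in>{1..Suc s}. of_bool (\<bar>x m - x n\<bar> \<le> real r / real N))"
proof -
  define u where "u = cell x N m"
  define v where "v = cell x N n"
  have "(\<Sum>j\<in>A. in_window x N s j m * in_window x N s j n)
      = (\<Sum>j\<in>A. of_bool (j \<le> min u v \<and> max u v < j + int s))"
    by (intro sum.cong) (auto simp: in_window_def u_def v_def)
  also have "\<dots> = real (card (A \<inter> {j. j \<le> min u v \<and> max u v < j + int s}))"
    using assms(1) by (simp add: sum_of_bool_eq Collect_conj_eq)
  also have "\<dots> \<le> real (card {max u v - int s + 1..min u v})"
    by (intro of_nat_mono card_mono) auto
  also have "\<dots> = real (nat (int s - \<bar>u - v\<bar>))"
    by (auto simp: max_def min_def abs_if algebra_simps)
  \<comment> \<open>Here the count passes from common windows to scales; \<open>nat\<close>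
    truncates to 0 when the cells are at least \<open>s\<close> apart.\<close>
  also have "\<dots> = real (card {nat \<bar>u - v\<bar> + 1..s})"
    by simp
  also have "\<dots> \<le> real (card ({1..Suc s} \<inter> {r. \<bar>x m - x n\<bar> \<le> real r / real N}))"
  proof (intro of_nat_mono card_mono subsetI)
    fix r assume r: "r \<in> {nat \<bar>u - v\<bar> + 1..s}"
    then have "of_int \<bar>u - v\<bar> + 1 \<le> real r" by (simp add: of_nat_nat) linarith
    with cell_diff_less[of N x m n] have "real N * \<bar>x m - x n\<bar> \<le> real r"
      by (simp add: u_def v_def)
    then have "\<bar>x m - x n\<bar> \<le> real r / real N"
      using assms(2) by (simp add: field_simps)
    with r show "r \<in> {1..Suc s} \<inter> {r. \<bar>x m - x n\<bar> \<le> real r / real N}" by auto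
  qed auto
  also have "\<dots> = (\<Sum>r\<in>{1..Suc s}. of_bool (\<bar>x m - x n\<bar> \<le> real r / real N))"
    by (simp add: sum_of_bool_eq del: sum.cl_ivl_Suc)
  finally show ?thesis .
qed


section \<open>Moments of the window counts\<close>

text \<open>Expanding the square counts, for each pair (m, n), the windows containing both points.
  The diagonal contributes \<open>s\<close> per point; the other pairs are bounded by
  \<open>sum_in_window_pair\<close> and regrouped by scale.\<close>

lemma sum_window_count_sq:
  assumes "N > 0" and x: "\<And>i. 1 \<le> i \<Longrightarrow> x i \<in> {0..1}"
  shows "(\<Sum>j\<in>{1 - int s..int N}. (window_count x N s j)\<^sup>2)
     \<le> real N * real s + (\<Sum>r\<in>{1..Suc s}. real (card (close_pairs x (real r) N)))"
proof -
  define A where "A = {1 - int s..int N}"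
  define B where "B = {1..N}"
  define P where "P r m n \<longleftrightarrow> \<bar>x m - x n\<bar> \<le> real r / real N" for r m n
  have diag: "(\<Sum>j\<in>A. in_window x N s j m * in_window x N s j m) = real s" if "m \<in> B" for m
  proof -
    have "(\<Sum>j\<in>A. in_window x N s j m * in_window x N s j m) = (\<Sum>j\<in>A. in_window x N s j m)"
      by (intro sum.cong) (auto simp: in_window_def)
    also have "\<dots> = real s"
      using cell_bounds[of x m N] x[of m] that by (intro sum_in_window) (auto simp: A_def B_def)
    finally show ?thesis .
  qed
  have "(\<Sum>j\<in>A. (window_count x N s j)\<^sup>2)
      = (\<Sum>j\<in>A. \<Sum>m\<in>B. \<Sum>n\<in>B. in_window x N s j m * in_window x N s j n)"
    by (simp add: window_count_def power2_eq_square sum_product B_def)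
  also have "\<dots> = (\<Sum>m\<in>B. \<Sum>j\<in>A. \<Sum>n\<in>B. in_window x N s j m * in_window x N s j n)"
    by (rule sum.swap)
  also have "\<dots> = (\<Sum>m\<in>B. \<Sum>n\<in>B. \<Sum>j\<in>A. in_window x N s j m * in_window x N s j n)"
    by (intro sum.cong refl sum.swap)
  also have "\<dots> \<le> (\<Sum>m\<in>B. \<Sum>n\<in>B.
      of_bool (m = n) * real s + (\<Sum>r\<in>{1..Suc s}. of_bool (m \<noteq> n \<and> P r m n)))"
  proof (intro sum_mono)
    fix m n assume "m \<in> B"
    then show "(\<Sum>j\<in>A. in_window x N s j m * in_window x N s j n)
      \<le> of_bool (m = n) * real s + (\<Sum>r\<in>{1..Suc s}. of_bool (m \<noteq> n \<and> P r m n))"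
      using sum_in_window_pair[of A N x s m n] diag[of m] assms(1)
      by (cases "m = n") (auto simp: A_def P_def)
  qed
  also have "\<dots> = real N * real s
      + (\<Sum>m\<in>B. \<Sum>n\<in>B. \<Sum>r\<in>{1..Suc s}. of_bool (m \<noteq> n \<and> P r m n))"
    by (simp add: sum.distrib of_bool_def if_distrib[of "\<lambda>t. t * real s"] B_def cong: if_cong)
  also have "(\<Sum>m\<in>B. \<Sum>n\<in>B. \<Sum>r\<in>{1..Suc s}. of_bool (m \<noteq> n \<and> P r m n))
      = (\<Sum>p\<in>B \<times> B. \<Sum>r\<in>{1..Suc s}. of_bool (fst p \<noteq> snd p \<and> P r (fst p) (snd p)))"
    by (simp add: sum.cartesian_product case_prod_beta)
  also have "\<dots> = (\<Sum>r\<in>{1..Suc s}. \<Sum>p\<in>B \<times> B. of_bool (fst p \<noteq> snd p \<and> P r (fst p) (snd p)))"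
    by (rule sum.swap)
  also have "\<dots> = (\<Sum>r\<in>{1..Suc s}. real (card (close_pairs x (real r) N)))"
  proof (intro sum.cong refl)
    fix r
    have "close_pairs x (real r) N = (B \<times> B) \<inter> {p. fst p \<noteq> snd p \<and> P r (fst p) (snd p)}"
      by (auto simp: close_pairs_def B_def P_def)
    then show "(\<Sum>p\<in>B \<times> B. of_bool (fst p \<noteq> snd p \<and> P r (fst p) (snd p)))
        = real (card (close_pairs x (real r) N))"
      by (simp add: B_def)
  qed
  finally show ?thesis by (simp add: A_def)
qed

lemma sum_window_count:
  assumes "\<And>i. 1 \<le> i \<Longrightarrow> x i \<in> {0..1}"
  shows "(\<Sum>j\<in>{1 - int s..int N}. window_count x N s j) = real N * real s"
proof -
  have "(\<Sum>j\<in>{1 - int s..int N}. window_count x N s j)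
      = (\<Sum>i\<in>{1..N}. \<Sum>j\<in>{1 - int s..int N}. in_window x N s j i)"
    unfolding window_count_def by (rule sum.swap)
  also have "\<dots> = (\<Sum>i\<in>{1..N}. real s)"
  proof (intro sum.cong refl sum_in_window)
    fix i assume "i \<in> {1..N}"
    then show "{cell x N i - int s + 1..cell x N i} \<subseteq> {1 - int s..int N}"
      using cell_bounds[of x i N] assms[of i] by auto
  qed auto
  finally show ?thesis by simp
qed

text \<open>There are \<open>N + s\<close> windows, so the mean terms combine to -2 N s^2 + (N + s)
  s^2 = -N s^2 + s^3. The cubic term is a boundary effect, independent of \<open>N\<close>.\<close>

lemma window_variance:
  assumes "N > 0" and "\<And>i. 1 \<le> i \<Longrightarrow> x i \<in> {0..1}"
  shows "(\<Sum>j\<in>{1 - int s..int N}. (window_count x N s j - real s)\<^sup>2)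
     \<le> real N * (real s - (real s)\<^sup>2) + real s ^ 3
       + (\<Sum>r\<in>{1..Suc s}. real (card (close_pairs x (real r) N)))"
proof -
  let ?A = "{1 - int s..int N}"
  have "(\<Sum>j\<in>?A. (window_count x N s j - real s)\<^sup>2)
      = (\<Sum>j\<in>?A. (window_count x N s j)\<^sup>2) - 2 * real s * (\<Sum>j\<in>?A. window_count x N s j)
        + (\<Sum>j\<in>?A. (real s)\<^sup>2)"
    by (simp add: power2_diff sum.distrib sum_subtractf sum_distrib_left algebra_simps)
  also have "(\<Sum>j\<in>?A. (real s)\<^sup>2) = (real N + real s) * (real s)\<^sup>2"
    by (simp add: nat_add_distrib flip: of_nat_add)
  also have "(\<Sum>j\<in>?A. window_count x N s j) = real N * real s"
    using assms(2) by (rule sum_window_count)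
  finally show ?thesis
    using sum_window_count_sq[of N x s, OF assms]
    by (simp add: algebra_simps power2_eq_square power3_eq_cube)
qed

section \<open>Upper bounds for closed intervals\<close>

text \<open>Each point in \<open>{a..b}\<close> lies in \<open>s\<close> windows of a range of about
  N (b - a) + s windows. The sum of the window counts over this range is compared with its mean
  value, the error being charged to the variance; \<open>e\<close> balances the two losses.\<close>

lemma interval_count_le:
  assumes N: "N > 0" and x: "\<And>i. 1 \<le> i \<Longrightarrow> x i \<in> {0..1}"
    and ab: "0 \<le> a" "a \<le> b" "b \<le> 1" and s: "s > 0" and e: "e > 0"
  shows "real (card {i. 1 \<le> i \<and> i \<le> N \<and> x i \<in> {a..b}})
     \<le> (1 + e) * (real N * (b - a) + real s + 1)
       + (real N * (real s - (real s)\<^sup>2) + real s ^ 3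
          + (\<Sum>r\<in>{1..Suc s}. real (card (close_pairs x (real r) N)))) / (4 * e * (real s)\<^sup>2)"
proof -
  define C where "C = {i. 1 \<le> i \<and> i \<le> N \<and> x i \<in> {a..b}}"
  \<comment> \<open>These are the starts of the windows that meet the cells from that of
    \<open>a\<close> to that of \<open>b\<close>.\<close>
  define I where "I = {\<lfloor>real N * a\<rfloor> - int s + 1..\<lfloor>real N * b\<rfloor>}"
  define F where "F = window_count x N s"
  define V where "V = real N * (real s - (real s)\<^sup>2) + real s ^ 3
          + (\<Sum>r\<in>{1..Suc s}. real (card (close_pairs x (real r) N)))"
  have C: "C \<subseteq> {1..N}" by (auto simp: C_def)
  have Nab: "0 \<le> real N * a" "real N * a \<le> real N * b" "real N * b \<le> real N"
    using ab by (auto intro: mult_left_mono simp: mult_left_le)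
  have I: "I \<subseteq> {1 - int s..int N}"
    using Nab unfolding I_def by (auto simp: le_floor_iff) linarith+
  have cardI: "real (card I) \<le> real N * (b - a) + real s + 1"
    using Nab by (simp add: I_def algebra_simps of_nat_nat) linarith
  \<comment> \<open>The bound y - s \<le> e s + (y - s)^2 / (4 e s) linearises the deviation, so
    that the variance bound applies directly after summation.\<close>
  have AMGM: "y \<le> real s * (1 + e) + (y - real s)\<^sup>2 / (4 * e * real s)" for y
  proof -
    have "0 \<le> (y - real s - 2 * e * real s)\<^sup>2 / (4 * e * real s)"
      using e by simp
    also have "\<dots> = real s * (1 + e) + (y - real s)\<^sup>2 / (4 * e * real s) - y"
      using e s by (simp add: field_simps power2_eq_square)
    finally show ?thesis by simp
  qed
  have "real s * real (card C) = (\<Sum>i\<in>C. \<Sum>j\<in>I. in_window x N s j i)"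
  proof -
    have "(\<Sum>j\<in>I. in_window x N s j i) = real s" if "i \<in> C" for i
    proof (rule sum_in_window)
      have "\<lfloor>real N * a\<rfloor> \<le> cell x N i" "cell x N i \<le> \<lfloor>real N * b\<rfloor>"
        using that unfolding cell_def C_def by (auto intro!: floor_mono mult_left_mono)
      then show "{cell x N i - int s + 1..cell x N i} \<subseteq> I" by (auto simp: I_def)
    qed (simp add: I_def)
    then show ?thesis by simp
  qed
  also have "\<dots> \<le> (\<Sum>i\<in>{1..N}. \<Sum>j\<in>I. in_window x N s j i)"
    using C by (intro sum_mono2 sum_nonneg) (auto simp: in_window_def)
  also have "\<dots> = (\<Sum>j\<in>I. F j)"
    unfolding F_def window_count_def by (rule sum.swap)
  also have "\<dots> \<le> (\<Sum>j\<in>I. real s * (1 + e) + (F j - real s)\<^sup>2 / (4 * e * real s))"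
    by (intro sum_mono AMGM)
  also have "\<dots> = real (card I) * (real s * (1 + e))
      + (\<Sum>j\<in>I. (F j - real s)\<^sup>2) / (4 * e * real s)"
    by (simp add: sum.distrib sum_divide_distrib)
  also have "\<dots> \<le> (real N * (b - a) + real s + 1) * (real s * (1 + e)) + V / (4 * e * real s)"
  proof (intro add_mono mult_right_mono divide_right_mono)
    have "(\<Sum>j\<in>I. (F j - real s)\<^sup>2) \<le> (\<Sum>j\<in>{1 - int s..int N}. (F j - real s)\<^sup>2)"
      using I by (intro sum_mono2) auto
    also have "\<dots> \<le> V"
      unfolding F_def V_def using N x by (rule window_variance)
    finally show "(\<Sum>j\<in>I. (F j - real s)\<^sup>2) \<le> V" .
  qed (use cardI e s in auto)
  also have "\<dots> = real s * ((1 + e) * (real N * (b - a) + real s + 1) + V / (4 * e * (real s)\<^sup>2))"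
    using s e by (simp add: field_simps power2_eq_square)
  finally show ?thesis
    using s by (simp add: C_def V_def)
qed

text \<open>With \<open>e\<close> and \<open>s\<close> fixed, \<open>N\<close> tends to infinity
  first. The remaining excess over b - a is e (b - a) plus a variance term of order 1 / (e s); each
  is at most d / 2.\<close>

lemma eventually_interval_count_less:
  assumes x: "\<And>n. 1 \<le> n \<Longrightarrow> x n \<in> {0..1}"
    and lim: "\<And>s::nat. 1 \<le> s \<Longrightarrow>
           (\<lambda>N. 1 / real N * real (card (close_pairs x (real s) N))) \<longlonglongrightarrow> 2 * real s"
    and ab: "0 \<le> a" "a \<le> b" "b \<le> 1" and d: "d > 0"
  shows "\<forall>\<^sub>F N in sequentially.
    1 / real N * real (card {i. 1 \<le> i \<and> i \<le> N \<and> x i \<in> {a..b}}) < b - a + d"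
proof -
  define e where "e = d / 2"
  have e: "e > 0" using d by (simp add: e_def)
  \<comment> \<open>The variance term will be bounded by 3 / (e s), which this choice makes smaller
    than \<open>e\<close>.\<close>
  obtain s :: nat where s': "real s > 3 / e\<^sup>2" using reals_Archimedean2 by blast
  with e have s: "s > 0" by (cases "s = 0") (auto simp: divide_less_0_iff)
  define g where "g N = (1 + e) * ((b - a) + (real s + 1) / real N)
    + ((real s - (real s)\<^sup>2) + real s ^ 3 / real N
       + (\<Sum>r\<in>{1..Suc s}. 1 / real N * real (card (close_pairs x (real r) N)))) / (4 * e * (real s)\<^sup>2)"
    for N
  \<comment> \<open>The zeros are the limits of the terms of order 1 / N; they keep \<open>L\<close>
    in the shape of \<open>g\<close>, so that the limit can be taken term by term.\<close>
  define L where "L = (1 + e) * ((b - a) + 0)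
    + ((real s - (real s)\<^sup>2) + 0 + (\<Sum>r\<in>{1..Suc s}. 2 * real r)) / (4 * e * (real s)\<^sup>2)"
  have "g \<longlonglongrightarrow> L"
    unfolding g_def L_def
    by (intro tendsto_intros lim lim_const_over_n) (use e s in auto)
  moreover have "L < b - a + d"
  proof -
    \<comment> \<open>The s^2 from this sum cancels against -s^2, leaving 4 s + 2 in the numerator
      of \<open>L\<close>.\<close>
    have "(\<Sum>r\<in>{1..Suc s}. 2 * real r) = (real s + 1) * (real s + 2)"
      by (induction s) (auto simp: algebra_simps)
    then have L: "L = (1 + e) * (b - a) + (4 * real s + 2) / (4 * e * (real s)\<^sup>2)"
      by (simp add: L_def algebra_simps power2_eq_square)
    have "(4 * real s + 2) / (4 * e * (real s)\<^sup>2) \<le> (12 * real s) / (4 * e * (real s)\<^sup>2)"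
      using s e by (intro divide_right_mono) auto
    also have "\<dots> = 3 / (e * real s)"
      using s e by (simp add: field_simps power2_eq_square)
    also have "\<dots> < e"
      using s e s' by (simp add: field_simps power2_eq_square)
    finally have "(4 * real s + 2) / (4 * e * (real s)\<^sup>2) < e" .
    moreover have "e * (b - a) \<le> e * 1"
      using e ab by (intro mult_left_mono) auto
    moreover have "(1 + e) * (b - a) = (b - a) + e * (b - a)" "d = 2 * e"
      by (simp_all add: e_def algebra_simps)
    ultimately show ?thesis unfolding L by linarith
  qed
  ultimately have "\<forall>\<^sub>F N in sequentially. g N < b - a + d"
    by (rule order_tendstoD)
  with eventually_gt_at_top[of 0] show ?thesis
  proof eventually_elim
    case (elim N)
    define S where "S = (\<Sum>r\<in>{1..Suc s}. real (card (close_pairs x (real r) N)))"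
    define V where "V = real N * (real s - (real s)\<^sup>2) + real s ^ 3 + S"
    have "1 / real N * real (card {i. 1 \<le> i \<and> i \<le> N \<and> x i \<in> {a..b}})
        \<le> 1 / real N * ((1 + e) * (real N * (b - a) + real s + 1) + V / (4 * e * (real s)\<^sup>2))"
      using interval_count_le[of N x a b s e, OF _ x ab s e] elim
      by (intro mult_left_mono) (auto simp: V_def S_def)
    also have "\<dots> = (1 + e) * (1 / real N * (real N * (b - a) + real s + 1))
        + 1 / real N * V / (4 * e * (real s)\<^sup>2)"
      by (simp only: distrib_left mult.left_commute times_divide_eq_right)
    also have "1 / real N * (real N * (b - a) + real s + 1) = (b - a) + (real s + 1) / real N"
      using elim by (simp add: field_simps)
    also have "1 / real N * V = (real s - (real s)\<^sup>2) + real s ^ 3 / real N + 1 / real N * S"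
      using elim by (simp add: V_def field_simps)
    also have "(1 + e) * ((b - a) + (real s + 1) / real N)
        + ((real s - (real s)\<^sup>2) + real s ^ 3 / real N + 1 / real N * S) / (4 * e * (real s)\<^sup>2) = g N"
      unfolding g_def S_def sum_distrib_left ..
    finally show ?case using elim by linarith
  qed
qed

section \<open>Endpoints and length of an interval\<close>

text \<open>The endpoints are \<open>Inf J\<close> and \<open>Sup J\<close>. This treats all types
  of nonempty bounded intervals at once, including single points.\<close>

lemma real_interval_sandwich:
  fixes J :: "real set"
  assumes "is_interval J" "J \<noteq> {}" "J \<subseteq> {c..d}"
  obtains a b where "c \<le> a" "a \<le> b" "b \<le> d" "{a<..<b} \<subseteq> J" "J \<subseteq> {a..b}"
proof
  have bdd: "bdd_below J" "bdd_above J"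
    using assms(3) by (meson bdd_below_mono bdd_above_mono bdd_below_Icc bdd_above_Icc)+
  show "c \<le> Inf J" using assms by (intro cInf_greatest) auto
  show "Sup J \<le> d" using assms by (intro cSup_least) auto
  show "Inf J \<le> Sup J" using assms bdd by (intro cInf_le_cSup) auto
  show "J \<subseteq> {Inf J..Sup J}" using bdd by (auto intro: cInf_lower cSup_upper)
  show "{Inf J<..<Sup J} \<subseteq> J"
  proof
    fix t assume "t \<in> {Inf J<..<Sup J}"
    then obtain u v where "u \<in> J" "u < t" "v \<in> J" "t < v"
      using assms(2) bdd by (auto simp: cInf_less_iff less_cSup_iff)
    then show "t \<in> J" using assms(1) unfolding is_interval_1 by (meson less_imp_le)
  qed
qed

text \<open>\<open>J\<close> is the open interval together with some of the two endpoints, hence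
  Borel; monotonicity of the measure then squeezes its length.\<close>

lemma measure_sandwiched_interval:
  fixes J :: "real set"
  assumes "{a<..<b} \<subseteq> J" "J \<subseteq> {a..b}" "a \<le> b"
  shows "measure lborel J = b - a"
proof -
  have "{a<..<b} \<union> (J \<inter> {a, b}) \<in> sets lborel"
    by (simp add: sets.Un borel_closed finite_imp_closed)
  also have "{a<..<b} \<union> (J \<inter> {a, b}) = J"
    using assms by force
  finally have J: "J \<in> sets lborel" .
  have ab: "{a..b} \<in> fmeasurable lborel"
    by (rule fmeasurable_compact) simp
  have "J \<in> fmeasurable lborel"
    using ab assms(2) J by (rule fmeasurableI2)
  then have "measure lborel {a<..<b} \<le> measure lborel J"
    using assms(1) by (intro measure_mono_fmeasurable) simp_all
  moreover have "measure lborel J \<le> measure lborel {a..b}"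
    using assms(2) J ab by (rule measure_mono_fmeasurable)
  ultimately show ?thesis using assms(3) by simp
qed

section \<open>From upper bounds to uniform distribution\<close>

theorem corollary3:
  fixes x :: "nat \<Rightarrow> real"
  assumes "\<And>n. 1 \<le> n \<Longrightarrow> x n \<in> {0..1}"
    and "\<And>s::nat. 1 \<le> s \<Longrightarrow>
           (\<lambda>N. 1 / real N * real (card (close_pairs x (real s) N))) \<longlonglongrightarrow> 2 * real s"
  shows "uniformly_distributed x"
  unfolding uniformly_distributed_def
proof (intro allI impI)
  fix J :: "real set" assume J: "is_interval J \<and> J \<subseteq> {0..1}"
  define D where "D K N = 1 / real N * real (card {i. 1 \<le> i \<and> i \<le> N \<and> x i \<in> K})" for K N
  have "D J \<longlonglongrightarrow> measure lborel J"
  proof (cases "J = {}")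
    case True
    then show ?thesis by (simp add: D_def[abs_def])
  next
    case False
    then obtain a b where ab: "0 \<le> a" "a \<le> b" "b \<le> 1" and *: "{a<..<b} \<subseteq> J" "J \<subseteq> {a..b}"
      using J real_interval_sandwich[of J 0 1] by blast
    have mono: "D K N \<le> D K' N" if "K \<subseteq> K'" for K K' N
      using that unfolding D_def by (intro mult_left_mono of_nat_mono card_mono) auto
    \<comment> \<open>The three sets cover [0,1] because \<open>J\<close> contains the open interval
      from \<open>a\<close> to \<open>b\<close>. They may overlap, so only an inequality results,
      but it turns upper bounds for the outer two into a lower bound for \<open>J\<close>.\<close>
    have cover: "1 \<le> D {0..a} N + D J N + D {b..1} N" if "N > 0" for N
    proof -
      let ?S = "\<lambda>K. {i. 1 \<le> i \<and> i \<le> N \<and> x i \<in> K}"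
      have "{1..N} \<subseteq> ?S {0..a} \<union> ?S J \<union> ?S {b..1}"
        using assms(1) * by force
      then have "card {1..N} \<le> card (?S {0..a} \<union> ?S J \<union> ?S {b..1})"
        by (intro card_mono) auto
      also have "\<dots> \<le> card (?S {0..a}) + card (?S J) + card (?S {b..1})"
        by (meson add_right_mono card_Un_le le_trans)
      finally show ?thesis
        using that by (simp add: D_def field_simps)
    qed
    note less = eventually_interval_count_less[of x, OF assms, folded D_def]
    have "D J \<longlonglongrightarrow> b - a"
    proof (rule order_tendstoI)
      fix y assume "b - a < y"
      then have "\<forall>\<^sub>F N in sequentially. D {a..b} N < y"
        using less[of a b "y - (b - a)"] ab by simp
      then show "\<forall>\<^sub>F N in sequentially. D J N < y"
        by eventually_elim (use mono[OF *(2)] in \<open>auto intro: le_less_trans\<close>)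
    next
      fix y assume y: "y < b - a"
      \<comment> \<open>The two outer intervals may each exceed their length by less than
        \<open>d\<close>, which leaves \<open>J\<close> more than b - a - 2 d = y.\<close>
      define d where "d = (b - a - y) / 2"
      have "d > 0" using y by (simp add: d_def)
      then have "\<forall>\<^sub>F N in sequentially. D {0..a} N < a - 0 + d"
        "\<forall>\<^sub>F N in sequentially. D {b..1} N < 1 - b + d"
        using less[of 0 a d] less[of b 1 d] ab by auto
      then show "\<forall>\<^sub>F N in sequentially. y < D J N"
        using eventually_gt_at_top[of 0]
      proof eventually_elim
        case (elim N)
        then show ?case using cover[of N] by (simp add: d_def field_simps)
      qed
    qed
    then show ?thesis using measure_sandwiched_interval[OF *] ab by simp
  qed
  then show "(\<lambda>N. 1 / real N * real (card {i. 1 \<le> i \<and> i \<le> N \<and> x i \<in> J}))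
      \<longlonglongrightarrow> measure lborel J"
    by (simp add: D_def[abs_def])
qed

end
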